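(* Let $(M,d)$ be a metric space with distinguished point $0$, let $f_1,\dots,f_N\in\mathrm{Lip}_0(M,M)$ and let $(n_k)_{k\ge1}$ be a strictly increasing sequence of positive integers. Suppose there exist dense subsets $M_0,M_1,\dots,M_N\subset M$ and mappings $g_{i,k}\colon M_i\to M$ ($1\le i\le N$, $k\ge 1$) such that: (i) $d(f_i^{n_k}(x_0),0)\to0$ as $k\to\infty$ for every $x_0\in M_0$ and $1\le i\le N$; (ii) $d(g_{i,k}(x_i),0)\to0$ as $k\to\infty$ for every $x_i\in M_i$ and $1\le i\le N$; (iii) for all $i,j\in\{1,\dots,N\}$ and every $x_j\in M_j$, $d\big((f_i^{n_k}\circ g_{j,k})(x_j),\Delta_{j,i}x_j\big)\to0$ as $k\to\infty$, where $\Delta_{j,i}x_j$ equals $x_j$ if $j=i$ and equals the distinguished point $0$ otherwise. Then the operators $T_{f_1},\dots,T_{f_N}$ on the Lipschitz-free space $\mathcal{F}(M)$ satisfy the Disjoint Hypercyclicity Criterion with respect to $(n_k)$. Consequently, the sequences $(T_{f_1}^{n_k})_{k\ge1},\dots,(T_{f_N}^{n_k})_{k\ge1}$ are disjoint mixing, and in particular $T_{f_1},\dots,T_{f_N}$ are disjoint transitive.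
   Context: $\mathrm{Lip}_0(M,M)$ is the set of Lipschitz maps $f\colon M\to M$ with $f(0)=0$. $\mathrm{Lip}_0(M)$ is the real Banach space of Lipschitz functions $M\to\mathbb{R}$ vanishing at $0$, normed by the best Lipschitz constant. For $x\in M$, $\delta_x\in \mathrm{Lip}_0(M)^*$ is evaluation at $x$; $\mathcal{F}(M):=\overline{\mathrm{span}}\{\delta_x:x\in M\}\subset \mathrm{Lip}_0(M)^*$, and $\|\delta_x-\delta_y\|=d(x,y)$. For $f\in\mathrm{Lip}_0(M,M)$, $T_f\colon\mathcal{F}(M)\to\mathcal{F}(M)$ is the unique bounded linear operator with $T_f(\delta_x)=\delta_{f(x)}$ for all $x\in M$. Disjoint Hypercyclicity Criterion: bounded operators $T_1,\dots,T_N$ on a Banach space $X$ satisfy it with respect to a strictly increasing sequence of positive integers $(n_k)$ if there exist dense subsets $X_0,X_1,\dots,X_N\subset X$ and mappings $S_{i,k}\colon X_i\to X$ ($1\le i\le N$, $k\ge1$) such that, as $k\to\infty$: $T_i^{n_k}\to0$ pointwise on $X_0$ for each $i$; $S_{i,k}\to0$ pointwise on $X_i$ for each $i$; and for all $i,j\in\{1,\dots,N\}$ and $x\in X_j$, $T_i^{n_k}S_{j,k}x\to x$ if $i=j$ and $T_i^{n_k}S_{j,k}x\to0$ if $i\ne j$. Sequences $(T_{1,k})_k,\dots,(T_{N,k})_k$ of bounded operators on $X$ are disjoint mixing if for all non-empty open $V_0,V_1,\dots,V_N\subset X$ there is $k_0$ such that $V_0\cap T_{1,k}^{-1}(V_1)\cap\dots\cap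 T_{N,k}^{-1}(V_N)\ne\emptyset$ for all $k\ge k_0$. Operators $T_1,\dots,T_N$ are disjoint transitive if for all non-empty open $V_0,\dots,V_N\subset X$ there is a non-negative integer $m$ with $V_0\cap T_1^{-m}(V_1)\cap\dots\cap T_N^{-m}(V_N)\ne\emptyset$, where $T_i^{-m}(\cdot)$ denotes preimage under $T_i^m$. *)

theory Defs
  imports "HOL-Analysis.Analysis"
begin

(* A pointed metric space is a type of sort {metric_space, zero}: the class zero carries no
   axioms, so its constant 0 is an arbitrary distinguished point. *)

definition lip0_maps :: "('a::{metric_space,zero} \<Rightarrow> 'a) set" where
  "lip0_maps = {f. (\<exists>C. C-lipschitz_on UNIV f) \<and> f 0 = 0}"


section \<open>The Banach space of Lipschitz functions vanishing at the distinguished point\<close>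

typedef (overloaded) 'a lip0 =
  "{\<phi> :: 'a::{metric_space,zero} \<Rightarrow> real. (\<exists>C. C-lipschitz_on UNIV \<phi>) \<and> \<phi> 0 = 0}"
  morphisms lip0_apply Lip0
  by (rule exI[of _ "\<lambda>_. 0"]) (auto intro: lipschitz_on_constant)

setup_lifting type_definition_lip0

definition lip_const :: "('a::metric_space \<Rightarrow> real) \<Rightarrow> real" where
  "lip_const \<phi> = Inf {C. C-lipschitz_on UNIV \<phi>}"

lemma lip_const_le: "C-lipschitz_on UNIV \<phi> \<Longrightarrow> lip_const \<phi> \<le> C"
  unfolding lip_const_def
  by (rule cInf_lower) (auto intro!: bdd_belowI[of _ 0] dest: lipschitz_on_nonneg)

lemma lip_const_lipschitz:
  assumes "C-lipschitz_on UNIV \<phi>"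
  shows "(lip_const \<phi>)-lipschitz_on UNIV \<phi>"
proof (rule lipschitz_onI)
  have ne: "{C. C-lipschitz_on UNIV \<phi>} \<noteq> {}"
    using assms by auto
  show "0 \<le> lip_const \<phi>"
    unfolding lip_const_def by (rule cInf_greatest[OF ne]) (auto dest: lipschitz_on_nonneg)
  fix x y
  show "dist (\<phi> x) (\<phi> y) \<le> lip_const \<phi> * dist x y"
  proof (cases "x = y")
    case False
    then have pos: "dist x y > 0" by simp
    have "dist (\<phi> x) (\<phi> y) / dist x y \<le> lip_const \<phi>"
      unfolding lip_const_def using pos
      by (intro cInf_greatest[OF ne]) (auto simp: divide_le_eq dest: lipschitz_onD)
    then show ?thesis using pos by (simp add: divide_le_eq)
  qed simp
qed

lemma lip0_lipschitz: "(lip_const (lip0_apply \<phi>))-lipschitz_on UNIV (lip0_apply \<phi>)"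
  using lip0_apply[of \<phi>] lip_const_lipschitz by blast

instantiation lip0 :: ("{metric_space,zero}") real_normed_vector
begin

lift_definition norm_lip0 :: "'a lip0 \<Rightarrow> real" is lip_const .

lift_definition zero_lip0 :: "'a lip0" is "\<lambda>_. 0"
  by (auto intro: lipschitz_on_constant)

lift_definition plus_lip0 :: "'a lip0 \<Rightarrow> 'a lip0 \<Rightarrow> 'a lip0" is "\<lambda>\<phi> \<psi> x. \<phi> x + \<psi> x"
  by (auto intro: lipschitz_on_add)

lift_definition minus_lip0 :: "'a lip0 \<Rightarrow> 'a lip0 \<Rightarrow> 'a lip0" is "\<lambda>\<phi> \<psi> x. \<phi> x - \<psi> x"
  by (auto intro: lipschitz_on_diff)

lift_definition uminus_lip0 :: "'a lip0 \<Rightarrow> 'a lip0" is "\<lambda>\<phi> x. - \<phi> x"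
  by auto

lift_definition scaleR_lip0 :: "real \<Rightarrow> 'a lip0 \<Rightarrow> 'a lip0" is "\<lambda>r \<phi> x. r *\<^sub>R \<phi> x"
  by (auto intro: lipschitz_on_cmult_real)

definition dist_lip0 :: "'a lip0 \<Rightarrow> 'a lip0 \<Rightarrow> real" where
  "dist_lip0 \<phi> \<psi> = norm (\<phi> - \<psi>)"

definition uniformity_lip0 :: "('a lip0 \<times> 'a lip0) filter" where
  "uniformity_lip0 = (INF e\<in>{0<..}. principal {(x, y). dist x y < e})"

definition open_lip0 :: "'a lip0 set \<Rightarrow> bool" where
  "open_lip0 S = (\<forall>x\<in>S. \<forall>\<^sub>F (x', y) in uniformity. x' = x \<longrightarrow> y \<in> S)"

definition sgn_lip0 :: "'a lip0 \<Rightarrow> 'a lip0" where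
  "sgn_lip0 \<phi> = inverse (norm \<phi>) *\<^sub>R \<phi>"

instance
proof
  fix \<phi> \<psi> :: "'a lip0" and a :: real
  show "(norm \<phi> = 0) = (\<phi> = 0)"
  proof transfer
    fix \<phi> :: "'a \<Rightarrow> real"
    assume *: "(\<exists>C. C-lipschitz_on UNIV \<phi>) \<and> \<phi> 0 = 0"
    show "(lip_const \<phi> = 0) = (\<phi> = (\<lambda>_. 0))"
    proof
      assume "lip_const \<phi> = 0"
      then have "0-lipschitz_on UNIV \<phi>" using * lip_const_lipschitz by metis
      then have "dist (\<phi> x) (\<phi> 0) \<le> 0 * dist x 0" for x
        by (rule lipschitz_onD) auto
      then show "\<phi> = (\<lambda>_. 0)" using * by auto
    next
      assume "\<phi> = (\<lambda>_. 0)"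
      then have "0-lipschitz_on UNIV \<phi>" by (simp add: lipschitz_on_constant)
      then show "lip_const \<phi> = 0"
        using lip_const_le lip_const_lipschitz lipschitz_on_nonneg by (metis order_antisym)
    qed
  qed
  show "norm (\<phi> + \<psi>) \<le> norm \<phi> + norm \<psi>"
    unfolding norm_lip0.rep_eq plus_lip0.rep_eq
    by (intro lip_const_le lipschitz_on_add lip0_lipschitz)
  have le: "norm (b *\<^sub>R \<xi>) \<le> \<bar>b\<bar> * norm \<xi>" for b and \<xi> :: "'a lip0"
    unfolding norm_lip0.rep_eq scaleR_lip0.rep_eq real_scaleR_def
    by (intro lip_const_le lipschitz_on_cmult_real lip0_lipschitz)
  show "norm (a *\<^sub>R \<phi>) = \<bar>a\<bar> * norm \<phi>"
  proof (cases "a = 0")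
    case True
    have "norm (0 *\<^sub>R \<phi>) \<le> 0" using le[of 0 \<phi>] by simp
    moreover have "0 \<le> norm \<xi>" for \<xi> :: "'a lip0"
      unfolding norm_lip0.rep_eq by (rule lipschitz_on_nonneg[OF lip0_lipschitz])
    ultimately show ?thesis using True by (simp add: order_antisym)
  next
    case False
    have "inverse a *\<^sub>R a *\<^sub>R \<phi> = \<phi>" using False by transfer auto
    then have "norm \<phi> \<le> \<bar>inverse a\<bar> * norm (a *\<^sub>R \<phi>)"
      using le[of "inverse a" "a *\<^sub>R \<phi>"] by simp
    then have "\<bar>a\<bar> * norm \<phi> \<le> norm (a *\<^sub>R \<phi>)" using False by (simp add: field_simps)
    then show ?thesis using le[of a \<phi>] by simp
  qed
qed (rule dist_lip0_def sgn_lip0_def uniformity_lip0_def open_lip0_def |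
    (transfer, simp add: fun_eq_iff algebra_simps))+

end


section \<open>Lipschitz-free spaces\<close>

lemma lip0_apply_zero [simp]: "lip0_apply \<phi> 0 = 0"
  by transfer simp

lemma lip0_dist_le: "\<bar>lip0_apply \<phi> x - lip0_apply \<phi> y\<bar> \<le> norm \<phi> * dist x y"
  using lipschitz_onD[OF lip0_lipschitz, of x y \<phi>]
  by (simp add: norm_lip0.rep_eq dist_real_def)

lift_definition delta :: "'a::{metric_space,zero} \<Rightarrow> 'a lip0 \<Rightarrow>\<^sub>L real" is "\<lambda>x \<phi>. lip0_apply \<phi> x"
proof -
  fix x :: 'a
  have "\<bar>lip0_apply \<phi> x\<bar> \<le> norm \<phi> * dist x 0" for \<phi>
    using lip0_dist_le[of \<phi> x 0] by simp
  moreover have "lip0_apply (\<phi> + \<psi>) x = lip0_apply \<phi> x + lip0_apply \<psi> x"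
    and "lip0_apply (r *\<^sub>R \<phi>) x = r *\<^sub>R lip0_apply \<phi> x" for \<phi> \<psi> r
    by (transfer, simp)+
  ultimately show "bounded_linear (\<lambda>\<phi>. lip0_apply \<phi> x)"
    by (intro bounded_linear_intro[where K = "dist x 0"]) auto
qed

typedef (overloaded) 'a lipfree =
  "closure (span (range (delta :: 'a::{metric_space,zero} \<Rightarrow> 'a lip0 \<Rightarrow>\<^sub>L real)))"
  morphisms lipfree_functional Lipfree
  using span_0 closure_subset by blast

setup_lifting type_definition_lipfree

lemma subspace_closure_span_delta:
  "subspace (closure (span (range (delta :: 'a::{metric_space,zero} \<Rightarrow> 'a lip0 \<Rightarrow>\<^sub>L real))))"
proof -
  let ?U = "span (range (delta :: 'a \<Rightarrow> 'a lip0 \<Rightarrow>\<^sub>L real))"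
  have "x + y \<in> closure ?U" if xy: "x \<in> closure ?U" "y \<in> closure ?U" for x y
  proof -
    from xy obtain a b where "\<forall>n. a n \<in> ?U" "a \<longlonglongrightarrow> x" "\<forall>n. b n \<in> ?U" "b \<longlonglongrightarrow> y"
      unfolding closure_sequential by blast
    then show ?thesis
      unfolding closure_sequential
      by (intro exI[of _ "\<lambda>n. a n + b n"]) (simp add: span_add tendsto_add)
  qed
  moreover have "c *\<^sub>R x \<in> closure ?U" if x: "x \<in> closure ?U" for c x
  proof -
    from x obtain a where "\<forall>n. a n \<in> ?U" "a \<longlonglongrightarrow> x"
      unfolding closure_sequential by blast
    then show ?thesis
      unfolding closure_sequential
      by (intro exI[of _ "\<lambda>n. c *\<^sub>R a n"]) (simp add: span_scale tendsto_scaleR)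
  qed
  moreover have "0 \<in> closure ?U"
    using span_0 closure_subset by blast
  ultimately show ?thesis by (simp add: subspace_def)
qed

instantiation lipfree :: ("{metric_space,zero}") real_normed_vector
begin

lift_definition norm_lipfree :: "'a lipfree \<Rightarrow> real" is norm .

lift_definition zero_lipfree :: "'a lipfree" is 0
  by (rule subspace_0[OF subspace_closure_span_delta])

lift_definition plus_lipfree :: "'a lipfree \<Rightarrow> 'a lipfree \<Rightarrow> 'a lipfree" is "(+)"
  by (rule subspace_add[OF subspace_closure_span_delta])

lift_definition minus_lipfree :: "'a lipfree \<Rightarrow> 'a lipfree \<Rightarrow> 'a lipfree" is "(-)"
  by (rule subspace_diff[OF subspace_closure_span_delta])

lift_definition uminus_lipfree :: "'a lipfree \<Rightarrow> 'a lipfree" is uminus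
  by (rule subspace_neg[OF subspace_closure_span_delta])

lift_definition scaleR_lipfree :: "real \<Rightarrow> 'a lipfree \<Rightarrow> 'a lipfree" is scaleR
  by (rule subspace_scale[OF subspace_closure_span_delta])

definition dist_lipfree :: "'a lipfree \<Rightarrow> 'a lipfree \<Rightarrow> real" where
  "dist_lipfree u v = norm (u - v)"

definition uniformity_lipfree :: "('a lipfree \<times> 'a lipfree) filter" where
  "uniformity_lipfree = (INF e\<in>{0<..}. principal {(x, y). dist x y < e})"

definition open_lipfree :: "'a lipfree set \<Rightarrow> bool" where
  "open_lipfree S = (\<forall>x\<in>S. \<forall>\<^sub>F (x', y) in uniformity. x' = x \<longrightarrow> y \<in> S)"

definition sgn_lipfree :: "'a lipfree \<Rightarrow> 'a lipfree" where
  "sgn_lipfree u = inverse (norm u) *\<^sub>R u"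

instance
  by standard
    (rule dist_lipfree_def sgn_lipfree_def uniformity_lipfree_def open_lipfree_def |
      (transfer, simp add: algebra_simps norm_triangle_ineq))+

end

lemma dist_lipfree_functional: "dist (lipfree_functional u) (lipfree_functional v) = dist u v"
  by (simp add: dist_norm norm_lipfree.rep_eq minus_lipfree.rep_eq)

instance lipfree :: ("{metric_space,zero}") banach
proof
  fix u :: "nat \<Rightarrow> 'a lipfree"
  assume "Cauchy u"
  then have "Cauchy (\<lambda>n. lipfree_functional (u n))"
    by (simp add: Cauchy_def dist_lipfree_functional)
  then obtain l where l: "(\<lambda>n. lipfree_functional (u n)) \<longlonglongrightarrow> l"
    using Cauchy_convergent by (auto simp: convergent_def)
  then have "l \<in> closure (span (range delta))"
    using lipfree_functional by (rule closed_sequentially[OF closed_closure, rotated])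
  then have "lipfree_functional (Lipfree l) = l"
    by (rule Lipfree_inverse)
  with l have "(\<lambda>n. lipfree_functional (u n)) \<longlonglongrightarrow> lipfree_functional (Lipfree l)"
    by simp
  then have "u \<longlonglongrightarrow> Lipfree l"
    by (simp add: tendsto_iff dist_lipfree_functional)
  then show "convergent u"
    by (auto simp: convergent_def)
qed

lift_definition dirac :: "'a::{metric_space,zero} \<Rightarrow> 'a lipfree" is delta
  by (meson closure_subset range_eqI span_base subsetD)

lemma dist_dirac: "norm (dirac x - dirac y) = dist x y"
proof (rule antisym)
  show "norm (dirac x - dirac y) \<le> dist x y"
  proof transfer
    fix x y :: 'a
    show "norm (delta x - delta y) \<le> dist x y"
      by (rule norm_blinfun_bound)
        (auto simp: blinfun.diff_left delta.rep_eq mult.commute lip0_dist_le)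
  qed
  define \<phi> where "\<phi> = Lip0 (\<lambda>z. dist z y - dist 0 y)"
  have lip: "1-lipschitz_on UNIV (\<lambda>z. dist z y - dist 0 y)"
    by (rule lipschitz_onI, simp add: dist_real_def, smt (verit) dist_commute dist_triangle)
      simp
  have ap: "lip0_apply \<phi> = (\<lambda>z. dist z y - dist 0 y)"
    unfolding \<phi>_def using lip by (intro Lip0_inverse) auto
  have n: "norm \<phi> \<le> 1"
    using lip_const_le[OF lip] by (simp add: norm_lip0.rep_eq ap)
  have "dist x y = (delta x - delta y) \<phi>"
    by (simp add: blinfun.diff_left delta.rep_eq ap)
  also have "\<dots> \<le> norm (delta x - delta y) * norm \<phi>"
    using norm_blinfun[of "delta x - delta y" \<phi>] by simp
  also have "\<dots> \<le> norm (delta x - delta y)"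
    using n by (simp add: mult_left_le)
  finally show "dist x y \<le> norm (dirac x - dirac y)"
    by (simp add: norm_lipfree.rep_eq minus_lipfree.rep_eq dirac.rep_eq)
qed

definition lipfree_map :: "('a::{metric_space,zero} \<Rightarrow> 'a) \<Rightarrow> 'a lipfree \<Rightarrow>\<^sub>L 'a lipfree" where
  "lipfree_map f = (THE T. \<forall>x. blinfun_apply T (dirac x) = dirac (f x))"

lemma closure_span_dirac: "closure (span (range dirac)) = UNIV"
proof -
  have fun_span: "\<exists>v \<in> span (range dirac). lipfree_functional v = w"
    if "w \<in> span (range delta)" for w :: "'a lip0 \<Rightarrow>\<^sub>L real"
    using that
  proof (induction rule: span_induct_alt)
    case base
    then show ?case by (metis span_0 zero_lipfree.rep_eq)
  next
    case (step c x y)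
    then obtain v z where "v \<in> span (range dirac)" "lipfree_functional v = y" "x = delta z"
      by auto
    then show ?case
      by (intro bexI[of _ "c *\<^sub>R dirac z + v"] span_add span_scale)
        (auto simp: plus_lipfree.rep_eq scaleR_lipfree.rep_eq dirac.rep_eq intro: span_base)
  qed
  have "u \<in> closure (span (range dirac))" for u :: "'a lipfree"
    unfolding closure_approachable
  proof (intro allI impI)
    fix e :: real
    assume "e > 0"
    moreover have "lipfree_functional u \<in> closure (span (range delta))"
      by (rule lipfree_functional)
    ultimately obtain w where "w \<in> span (range delta)" "dist w (lipfree_functional u) < e"
      unfolding closure_approachable by blast
    then show "\<exists>v\<in>span (range dirac). dist v u < e"
      using fun_span dist_lipfree_functional by metis
  qed
  then show ?thesis by auto
qed

lemma lipfree_map_unique: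
  fixes T U :: "'a::{metric_space,zero} lipfree \<Rightarrow>\<^sub>L 'a lipfree"
  assumes "\<And>x. T (dirac x) = U (dirac x)"
  shows "T = U"
proof -
  have zero: "(T - U) u = 0" if "u \<in> range dirac" for u
    using that assms by (auto simp: blinfun.diff_left)
  have "(T - U) u = 0" if "u \<in> span (range dirac)" for u
    by (rule linear_eq_0_on_span[OF bounded_linear.linear[OF blinfun.bounded_linear_right] _ that])
      (rule zero)
  moreover have "closed {u. (T - U) u = 0}"
    by (rule closed_Collect_eq)
      (rule linear_continuous_on blinfun.bounded_linear_right continuous_on_const)+
  ultimately have "closure (span (range dirac)) \<subseteq> {u. (T - U) u = 0}"
    by (intro closure_minimal subsetI CollectI)
  then have "(T - U) u = 0" for u
    unfolding closure_span_dirac by blast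
  then show ?thesis
    by (intro blinfun_eqI) (simp add: blinfun.diff_left)
qed

(* Existence: the adjoint of composition with f maps the functional at x to the one at f x, hence
   leaves the closed span of these functionals invariant. *)
lemma lipfree_map_exists:
  assumes "f \<in> lip0_maps"
  shows "\<exists>T. \<forall>x. blinfun_apply T (dirac x) = dirac (f x)"
proof -
  from assms obtain C where C: "C-lipschitz_on UNIV f" and f0: "f 0 = 0"
    by (auto simp: lip0_maps_def)
  have comp: "(D * C)-lipschitz_on UNIV (\<lambda>x. \<phi> (f x))"
    if "D-lipschitz_on UNIV \<phi>" for D and \<phi> :: "'a \<Rightarrow> real"
    using lipschitz_on_compose2[OF C lipschitz_on_subset[OF that]] by (simp add: o_def)
  define K where "K \<phi> = Lip0 (\<lambda>x. lip0_apply \<phi> (f x))" for \<phi>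
  have lip: "(norm \<phi>)-lipschitz_on UNIV (lip0_apply \<phi>)" for \<phi> :: "'a lip0"
    unfolding norm_lip0.rep_eq by (rule lip0_lipschitz)
  have ap: "lip0_apply (K \<phi>) x = lip0_apply \<phi> (f x)" for \<phi> x
    unfolding K_def using comp[OF lip, of \<phi>] f0 by (subst Lip0_inverse) auto
  have K: "bounded_linear K"
  proof (rule bounded_linear_intro[where K = C])
    show "norm (K \<phi>) \<le> norm \<phi> * C" for \<phi>
      unfolding norm_lip0.rep_eq[of "K \<phi>"] ap[abs_def] by (intro lip_const_le comp lip)
  qed (auto simp: lip0_apply_inject[symmetric] ap plus_lip0.rep_eq scaleR_lip0.rep_eq)
  define A :: "('a lip0 \<Rightarrow>\<^sub>L real) \<Rightarrow> 'a lip0 \<Rightarrow>\<^sub>L real" where "A u = u o\<^sub>L Blinfun K" for u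
  have A: "bounded_linear A"
    unfolding A_def by (rule bounded_bilinear.bounded_linear_left[OF bounded_bilinear_blinfun_compose])
  have A_delta: "A (delta x) = delta (f x)" for x
    by (rule blinfun_eqI) (simp add: A_def delta.rep_eq bounded_linear_Blinfun_apply[OF K] ap)
  have "A ` span (range delta) = span (A ` range delta)"
    by (rule linear_span_image[symmetric]) (rule bounded_linear.linear[OF A])
  also have "\<dots> \<subseteq> span (range delta)"
    using A_delta by (intro span_mono) auto
  finally have "A ` span (range delta) \<subseteq> closure (span (range delta))"
    using closure_subset by blast
  then have "A ` closure (span (range delta)) \<subseteq> closure (span (range delta))"
    by (intro image_closure_subset linear_continuous_on A) auto
  then have fl: "lipfree_functional (Lipfree (A (lipfree_functional u))) = A (lipfree_functional u)"
    for u
    using lipfree_functional by (intro Lipfree_inverse) blast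
  define T where "T u = Lipfree (A (lipfree_functional u))" for u
  have T: "lipfree_functional (T u) = A (lipfree_functional u)" for u
    unfolding T_def by (rule fl)
  from bounded_linear.bounded[OF A] obtain B where B: "\<And>u. norm (A u) \<le> norm u * B"
    by blast
  interpret A: bounded_linear A by (rule A)
  have "bounded_linear T"
    by (rule bounded_linear_intro[where K = B])
      (simp_all add: T lipfree_functional_inject[symmetric] plus_lipfree.rep_eq
        scaleR_lipfree.rep_eq norm_lipfree.rep_eq A.add A.scaleR B)
  then show ?thesis
    by (intro exI[of _ "Blinfun T"])
      (simp add: bounded_linear_Blinfun_apply lipfree_functional_inject[symmetric] T
        dirac.rep_eq A_delta)
qed

lemma lipfree_map_dirac:
  assumes "f \<in> lip0_maps"
  shows "lipfree_map f (dirac x) = dirac (f x)"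
proof -
  have "\<exists>!T. \<forall>x. blinfun_apply T (dirac x) = dirac (f x)"
    using lipfree_map_exists[OF assms] by (auto intro!: lipfree_map_unique)
  from theI'[OF this] show ?thesis
    by (simp add: lipfree_map_def)
qed


section \<open>Disjoint dynamics of bounded operators\<close>

primrec blinfun_power :: "('x::real_normed_vector \<Rightarrow>\<^sub>L 'x) \<Rightarrow> nat \<Rightarrow> 'x \<Rightarrow>\<^sub>L 'x" where
  "blinfun_power T 0 = id_blinfun"
| "blinfun_power T (Suc m) = T o\<^sub>L blinfun_power T m"

(* Operators are indexed by 1..N and sequences by k = 1, 2, ...; values of the indexed families
   elsewhere, and of S i k outside X i, play no role. *)

definition disjoint_hypercyclicity_criterion ::
    "nat \<Rightarrow> (nat \<Rightarrow> 'x::banach \<Rightarrow>\<^sub>L 'x) \<Rightarrow> (nat \<Rightarrow> nat) \<Rightarrow> bool" where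
  "disjoint_hypercyclicity_criterion N T n \<longleftrightarrow>
     strict_mono_on {1..} n \<and> (\<forall>k\<ge>1. n k > 0) \<and>
     (\<exists>(X :: nat \<Rightarrow> 'x set) (S :: nat \<Rightarrow> nat \<Rightarrow> 'x \<Rightarrow> 'x).
        (\<forall>i\<in>{0..N}. closure (X i) = UNIV) \<and>
        (\<forall>i\<in>{1..N}. \<forall>x\<in>X 0. (\<lambda>k. blinfun_power (T i) (n k) x) \<longlonglongrightarrow> 0) \<and>
        (\<forall>i\<in>{1..N}. \<forall>x\<in>X i. (\<lambda>k. S i k x) \<longlonglongrightarrow> 0) \<and>
        (\<forall>i\<in>{1..N}. \<forall>j\<in>{1..N}. \<forall>x\<in>X j.
           (\<lambda>k. blinfun_power (T i) (n k) (S j k x)) \<longlonglongrightarrow> (if i = j then x else 0)))"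

definition disjoint_mixing :: "nat \<Rightarrow> (nat \<Rightarrow> nat \<Rightarrow> 'x::banach \<Rightarrow>\<^sub>L 'x) \<Rightarrow> bool" where
  "disjoint_mixing N T \<longleftrightarrow>
     (\<forall>V :: nat \<Rightarrow> 'x set. (\<forall>i\<in>{0..N}. open (V i) \<and> V i \<noteq> {}) \<longrightarrow>
        (\<exists>k0\<ge>1. \<forall>k\<ge>k0. V 0 \<inter> (\<Inter>i\<in>{1..N}. blinfun_apply (T i k) -` V i) \<noteq> {}))"

definition disjoint_transitive :: "nat \<Rightarrow> (nat \<Rightarrow> 'x::banach \<Rightarrow>\<^sub>L 'x) \<Rightarrow> bool" where
  "disjoint_transitive N T \<longleftrightarrow>
     (\<forall>V :: nat \<Rightarrow> 'x set. (\<forall>i\<in>{0..N}. open (V i) \<and> V i \<noteq> {}) \<longrightarrow>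
        (\<exists>m. V 0 \<inter> (\<Inter>i\<in>{1..N}. blinfun_apply (blinfun_power (T i) m) -` V i) \<noteq> {}))"

end

theory Submission
  imports Defs
begin

text \<open>On the linear span of the Dirac elements over \<open>M i\<close>, the maps \<open>S i k\<close> need not be linear: the
  points \<open>u\<close> for which a suitable sequence of approximate preimages exists form a subspace, and
  this subspace contains the Dirac elements over \<open>M i\<close>, so the \<open>S i k\<close> come from the axiom of choice.
  For mixing, perturb a point \<open>x\<^sub>0\<close> of \<open>V 0 \<inter> X 0\<close> by the sum of \<open>S j k x\<^sub>j\<close> with \<open>x\<^sub>j\<close> in
  \<open>V j \<inter> X j\<close>.\<close>

lemma disjoint_mixing_of_criterion:
  fixes T :: "nat \<Rightarrow> 'x::banach \<Rightarrow>\<^sub>L 'x"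
  assumes "disjoint_hypercyclicity_criterion N T n"
  shows "disjoint_mixing N (\<lambda>i k. blinfun_power (T i) (n k))"
  unfolding disjoint_mixing_def
proof (intro allI impI)
  fix V :: "nat \<Rightarrow> 'x set"
  assume V: "\<forall>i\<in>{0..N}. open (V i) \<and> V i \<noteq> {}"
  from assms obtain X :: "nat \<Rightarrow> 'x set" and S :: "nat \<Rightarrow> nat \<Rightarrow> 'x \<Rightarrow> 'x" where
    dense: "\<forall>i\<in>{0..N}. closure (X i) = UNIV" and
    X0: "\<forall>i\<in>{1..N}. \<forall>x\<in>X 0. (\<lambda>k. blinfun_power (T i) (n k) x) \<longlonglongrightarrow> 0" and
    S: "\<forall>i\<in>{1..N}. \<forall>x\<in>X i. (\<lambda>k. S i k x) \<longlonglongrightarrow> 0" and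
    TS: "\<forall>i\<in>{1..N}. \<forall>j\<in>{1..N}. \<forall>x\<in>X j.
           (\<lambda>k. blinfun_power (T i) (n k) (S j k x)) \<longlonglongrightarrow> (if i = j then x else 0)"
    unfolding disjoint_hypercyclicity_criterion_def by (elim conjE exE)
  have "\<exists>x. x \<in> V i \<inter> X i" if "i \<in> {0..N}" for i
    using open_Int_closure_eq_empty[of "V i" "X i"] V dense that by auto
  then obtain x where x: "\<And>i. i \<in> {0..N} \<Longrightarrow> x i \<in> V i" "\<And>i. i \<in> {0..N} \<Longrightarrow> x i \<in> X i"
    by (metis IntE)
  define z where "z k = x 0 + (\<Sum>j\<in>{1..N}. S j k (x j))" for k
  have "z \<longlonglongrightarrow> x 0 + (\<Sum>j\<in>{1..N}. 0)"
    unfolding z_def by (intro tendsto_intros S[rule_format] x) auto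
  then have z0: "z \<longlonglongrightarrow> x 0" by simp
  have zi: "(\<lambda>k. blinfun_power (T i) (n k) (z k)) \<longlonglongrightarrow> x i" if i: "i \<in> {1..N}" for i
  proof -
    have "(\<lambda>k. blinfun_power (T i) (n k) (x 0) +
             (\<Sum>j\<in>{1..N}. blinfun_power (T i) (n k) (S j k (x j))))
          \<longlonglongrightarrow> 0 + (\<Sum>j\<in>{1..N}. if i = j then x j else 0)"
      using i by (intro tendsto_add tendsto_sum X0[rule_format] TS[rule_format] x) auto
    then show ?thesis
      using i by (simp add: z_def blinfun.add_right blinfun.sum_right)
  qed
  have "\<forall>\<^sub>F k in sequentially. z k \<in> V 0 \<and>
          (\<forall>i\<in>{1..N}. blinfun_power (T i) (n k) (z k) \<in> V i)"
    using V x by (intro eventually_conj eventually_ball_finite ballI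
        topological_tendstoD[OF z0] topological_tendstoD[OF zi]) auto
  then obtain k0 where "\<And>k. k \<ge> k0 \<Longrightarrow> z k \<in> V 0 \<and>
          (\<forall>i\<in>{1..N}. blinfun_power (T i) (n k) (z k) \<in> V i)"
    unfolding eventually_sequentially by blast
  then show "\<exists>k0\<ge>1. \<forall>k\<ge>k0.
      V 0 \<inter> (\<Inter>i\<in>{1..N}. blinfun_apply (blinfun_power (T i) (n k)) -` V i) \<noteq> {}"
    \<comment> \<open>The threshold \<open>k0\<close> may be 0, while the sequences are indexed from
      1.\<close>
    by (intro exI[of _ "max 1 k0"]) fastforce
qed

text \<open>Mixing at a single index \<open>k = k0\<close> already supplies the required exponent,
  \<open>m = n k0\<close>.\<close>

lemma disjoint_transitive_of_mixing:
  assumes "disjoint_mixing N (\<lambda>i k. blinfun_power (T i) (n k))"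
  shows "disjoint_transitive N T"
  using assms unfolding disjoint_mixing_def disjoint_transitive_def by blast

text \<open>All functions in the predual pairing vanish at the distinguished point, so evaluation
  there is the zero functional. This is how convergence to that point in the metric space becomes
  convergence to the zero vector.\<close>

lemma dirac_zero [simp]: "dirac 0 = 0"
  by transfer (auto intro!: blinfun_eqI simp: delta.rep_eq)

text \<open>Holds because \<open>dirac\<close> is an isometric embedding; it carries the metric
  hypotheses over to the free space.\<close>

lemma tendsto_dirac_iff: "((\<lambda>k. dirac (h k)) \<longlongrightarrow> dirac x) F \<longleftrightarrow> ((\<lambda>k. dist (h k) x) \<longlongrightarrow> 0) F"
  by (simp add: tendsto_dist_iff[of _ "dirac x"] dist_norm dist_dirac)

lemma tendsto_dirac_zero_iff: "((\<lambda>k. dirac (h k)) \<longlongrightarrow> 0) F \<longleftrightarrow> ((\<lambda>k. dist (h k) 0) \<longlongrightarrow> 0) F"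
  using tendsto_dirac_iff[of h 0 F] by simp

lemma subspace_closure:
  fixes S :: "'b::real_normed_vector set"
  assumes "subspace S"
  shows "subspace (closure S)"
  unfolding subspace_def
proof (intro conjI allI ballI)
  show "0 \<in> closure S"
    using subspace_0[OF assms] closure_subset by blast
next
  fix x y assume "x \<in> closure S" "y \<in> closure S"
  then obtain a b where "\<forall>k. a k \<in> S" "a \<longlonglongrightarrow> x" "\<forall>k. b k \<in> S" "b \<longlonglongrightarrow> y"
    unfolding closure_sequential by blast
  then show "x + y \<in> closure S"
    unfolding closure_sequential
    by (intro exI[of _ "\<lambda>k. a k + b k"]) (simp add: subspace_add[OF assms] tendsto_add)
next
  fix c x assume "x \<in> closure S"
  then obtain a where "\<forall>k. a k \<in> S" "a \<longlonglongrightarrow> x"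
    unfolding closure_sequential by blast
  then show "c *\<^sub>R x \<in> closure S"
    unfolding closure_sequential
    by (intro exI[of _ "\<lambda>k. c *\<^sub>R a k"]) (simp add: subspace_scale[OF assms] tendsto_scaleR)
qed

text \<open>By continuity of the isometry \<open>dirac\<close>, a closed subspace containing the
  Dirac elements over a dense set contains all of them, and these span a dense subspace. This gives
  the density of each \<open>X i\<close>.\<close>

lemma closure_span_dirac_image:
  fixes A :: "'a::{metric_space,zero} set"
  assumes "closure A = UNIV"
  shows "closure (span (dirac ` A)) = UNIV"
proof -
  let ?C = "closure (span (dirac ` A))"
  have "continuous_on UNIV (dirac :: 'a \<Rightarrow> 'a lipfree)"
    unfolding continuous_on_iff by (auto simp: dist_norm dist_dirac)
  then have "dirac ` closure A \<subseteq> closure (dirac ` A)"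
    using assms by (intro image_closure_subset) (auto intro: closure_subset[THEN subsetD])
  also have "\<dots> \<subseteq> ?C"
    by (intro closure_mono) (auto intro: span_base)
  finally have "range dirac \<subseteq> ?C"
    using assms by simp
  moreover have "subspace ?C"
    by (rule subspace_closure) simp
  ultimately have "span (range dirac) \<subseteq> ?C"
    by (rule span_minimal)
  then have "closure (span (range dirac)) \<subseteq> ?C"
    by (simp add: closure_minimal)
  then show ?thesis
    using closure_span_dirac by auto
qed

lemma blinfun_power_lipfree_map_dirac:
  assumes "f \<in> lip0_maps"
  shows "blinfun_power (lipfree_map f) m (dirac x) = dirac ((f ^^ m) x)"
  by (induction m) (simp_all add: lipfree_map_dirac[OF assms])

theorem theorem5p2:
  fixes N :: nat
    and f :: "nat \<Rightarrow> 'a::{metric_space,zero} \<Rightarrow> 'a"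
    and n :: "nat \<Rightarrow> nat"
    and M :: "nat \<Rightarrow> 'a set"
    and g :: "nat \<Rightarrow> nat \<Rightarrow> 'a \<Rightarrow> 'a"
  assumes "N \<ge> 1"
    and "\<forall>i\<in>{1..N}. f i \<in> lip0_maps"
    and "strict_mono_on {1..} n" and "\<forall>k\<ge>1. n k > 0"
    and "\<forall>i\<in>{0..N}. closure (M i) = UNIV"
    and "\<forall>i\<in>{1..N}. \<forall>x\<in>M 0. (\<lambda>k. dist ((f i ^^ n k) x) 0) \<longlonglongrightarrow> 0"
    and "\<forall>i\<in>{1..N}. \<forall>x\<in>M i. (\<lambda>k. dist (g i k x) 0) \<longlonglongrightarrow> 0"
    and "\<forall>i\<in>{1..N}. \<forall>j\<in>{1..N}. \<forall>x\<in>M j.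
           (\<lambda>k. dist (((f i ^^ n k) \<circ> g j k) x) (if j = i then x else 0)) \<longlonglongrightarrow> 0"
  shows "disjoint_hypercyclicity_criterion N (\<lambda>i. lipfree_map (f i)) n \<and>
         disjoint_mixing N (\<lambda>i k. blinfun_power (lipfree_map (f i)) (n k)) \<and>
         disjoint_transitive N (\<lambda>i. lipfree_map (f i))"
proof -
  note power_dirac = blinfun_power_lipfree_map_dirac[OF bspec[OF assms(2)]]
  define T where "T i k = blinfun_power (lipfree_map (f i)) (n k)" for i k
  define X where "X i = span (dirac ` M i)" for i
  \<comment> \<open>The vectors \<open>u\<close> with \<open>T i k u\<close> tending to 0 form a
    subspace, so the Dirac elements over \<open>M 0\<close> suffice.\<close>
  have T0: "(\<lambda>k. T i k u) \<longlonglongrightarrow> 0" if i: "i \<in> {1..N}" and "u \<in> X 0" for i u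
    using that(2) unfolding X_def
  proof (induction rule: span_induct_alt)
    case (step c u v)
    then obtain x where x: "x \<in> M 0" "u = dirac x" by auto
    then have "(\<lambda>k. T i k u) \<longlonglongrightarrow> 0"
      using assms(6) i by (simp add: T_def power_dirac tendsto_dirac_zero_iff)
    then have "(\<lambda>k. c *\<^sub>R T i k u + T i k v) \<longlonglongrightarrow> c *\<^sub>R 0 + 0"
      by (intro tendsto_intros step.IH)
    then show ?case by (simp add: blinfun.add_right blinfun.scaleR_right)
  qed (simp add: blinfun.zero_right)
  \<comment> \<open>The quantifier over \<open>i\<close> stands inside, since one sequence
    \<open>s\<close> has to serve all the operators at once.\<close>
  have "\<exists>s. s \<longlonglongrightarrow> 0 \<and> (\<forall>i\<in>{1..N}. (\<lambda>k. T i k (s k)) \<longlonglongrightarrow> (if i = j then u else 0))"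
    if j: "j \<in> {1..N}" and "u \<in> X j" for j u
    using that(2) unfolding X_def
  proof (induction rule: span_induct_alt)
    case base
    show ?case by (intro exI[of _ "\<lambda>_. 0"]) (simp add: blinfun.zero_right)
  next
    case (step c u v)
    then obtain x where x: "x \<in> M j" "u = dirac x" by auto
    let ?t = "\<lambda>k. dirac (g j k x)"
    from step.IH obtain s where s: "s \<longlonglongrightarrow> 0"
      "\<And>i. i \<in> {1..N} \<Longrightarrow> (\<lambda>k. T i k (s k)) \<longlonglongrightarrow> (if i = j then v else 0)"
      by blast
    have t: "?t \<longlonglongrightarrow> 0"
      using assms(7) j x by (simp add: tendsto_dirac_zero_iff)
    have Tt: "(\<lambda>k. T i k (?t k)) \<longlonglongrightarrow> (if i = j then u else 0)" if i: "i \<in> {1..N}" for i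
    proof -
      \<comment> \<open>The limit is kept in the form \<open>dirac _\<close>, with
        \<open>dirac_zero\<close> withheld, so that \<open>tendsto_dirac_iff\<close> matches; for
        \<open>j \<noteq> i\<close> it is \<open>dirac 0\<close>, the zero vector.\<close>
      have "(\<lambda>k. dirac ((f i ^^ n k) (g j k x))) \<longlonglongrightarrow> dirac (if j = i then x else 0)"
        using assms(8) i j x by (simp add: tendsto_dirac_iff del: dirac_zero)
      then show ?thesis
        using i x by (auto simp: T_def power_dirac split: if_splits)
    qed
    have "(\<lambda>k. c *\<^sub>R ?t k + s k) \<longlonglongrightarrow> c *\<^sub>R 0 + 0"
      by (intro tendsto_intros t s)
    moreover have "(\<lambda>k. T i k (c *\<^sub>R ?t k + s k)) \<longlonglongrightarrow> (if i = j then c *\<^sub>R u + v else 0)"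
      if i: "i \<in> {1..N}" for i
      using tendsto_add[OF tendsto_scaleR[OF tendsto_const Tt[OF i], of c] s(2)[OF i]]
      by (simp add: blinfun.add_right blinfun.scaleR_right split: if_splits)
    ultimately show ?case
      by (intro exI[of _ "\<lambda>k. c *\<^sub>R ?t k + s k"]) simp
  qed
  \<comment> \<open>A whole sequence is chosen for each pair of \<open>j\<close> and
    \<open>u\<close>; its term at \<open>k\<close> becomes the value of \<open>S j k\<close> at
    \<open>u\<close>.\<close>
  then obtain s where s: "\<And>j u. j \<in> {1..N} \<Longrightarrow> u \<in> X j \<Longrightarrow> s j u \<longlonglongrightarrow> 0 \<and>
      (\<forall>i\<in>{1..N}. (\<lambda>k. T i k (s j u k)) \<longlonglongrightarrow> (if i = j then u else 0))"
    by metis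
  have "closure (X i) = UNIV" if "i \<in> {0..N}" for i
    unfolding X_def using assms(5) that by (intro closure_span_dirac_image) auto
  then have crit: "disjoint_hypercyclicity_criterion N (\<lambda>i. lipfree_map (f i)) n"
    unfolding disjoint_hypercyclicity_criterion_def T_def[symmetric]
    using assms(3,4) T0 s
    by (intro conjI exI[of _ X] exI[of _ "\<lambda>i k u. s i u k"]) blast+
  then show ?thesis
    using disjoint_mixing_of_criterion[OF crit]
      disjoint_transitive_of_mixing[OF disjoint_mixing_of_criterion[OF crit]]
    by simp
qed

end
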